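(* Let $\bar a=(a_1,\dots,a_s)$ be a composition of $n$, let $l$ be a non-negative integer with $2l\le \min_{i\in[s]} a_i$, and let $t$ be a positive integer. Then the complementary sections $\mathrm{CL}^t(\bar a,l)$ and $\mathrm{CL}^{n-t}(\bar a,l)$ of the chainlink polytope have the same Ehrhart quasi-polynomial: $$\operatorname{Ehr}\,\mathrm{CL}^t(\bar a,l)=\operatorname{Ehr}\,\mathrm{CL}^{n-t}(\bar a,l).$$
   Context: A composition of $n$ is a tuple $\bar a=(a_1,\dots,a_s)$ of positive integers with $a_1+\dots+a_s=n$. The chainlink polytope is $$\mathrm{CL}(\bar a,l)=\{x\in\mathbb{R}^s : 0\le x_i\le a_i,\ x_i-x_{i+1}\le a_i-l \text{ for all } i\in[s]\},$$ with indices cyclic modulo $s$ (so $x_{s+1}=x_1$). For real $t$, its section is $\mathrm{CL}^t(\bar a,l)=\mathrm{CL}(\bar a,l)\cap\{x_1+\dots+x_s=t\}$. For a rational polytope $P\subset\mathbb{R}^s$, $\operatorname{Ehr} P$ is the quasi-polynomial function $k\mapsto \#(kP\cap\mathbb{Z}^s)$ of positive integers $k$ (identically $0$ if $P$ is empty). *)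

theory Defs
  imports Complex_Main "HOL-Library.FuncSet"
begin

text \<open>
  Points of \<open>s\<close>-dimensional real space are real lists of length \<open>s\<close>, with coordinates
  indexed from \<open>0\<close> to \<open>s - 1\<close>.
\<close>

text \<open>Compositions are taken to have at least one part.\<close>

definition composition :: "nat list \<Rightarrow> nat \<Rightarrow> bool" where
  "composition a n \<longleftrightarrow> a \<noteq> [] \<and> (\<forall>p\<in>set a. 0 < p) \<and> sum_list a = n"

definition chainlink :: "nat list \<Rightarrow> nat \<Rightarrow> real list set" where
  "chainlink a l = {x. length x = length a \<and>
     (\<forall>i<length a. 0 \<le> x ! i \<and> x ! i \<le> real (a ! i) \<and>
        x ! i - x ! ((i + 1) mod length a) \<le> real (a ! i) - real l)}"

definition chainlink_section :: "nat list \<Rightarrow> nat \<Rightarrow> real \<Rightarrow> real list set" where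
  "chainlink_section a l t = chainlink a l \<inter> {x. sum_list x = t}"

definition dilate :: "nat \<Rightarrow> real list set \<Rightarrow> real list set" where
  "dilate k P = map (\<lambda>y. real k * y) ` P"

text \<open>
  A function of positive integers only, hence \<open>undefined\<close> at \<open>0\<close>.
  It counts lattice points only for bounded \<open>P\<close>, since \<open>card\<close> is \<open>0\<close> on infinite sets.
\<close>

definition ehrhart :: "real list set \<Rightarrow> nat \<Rightarrow> nat" where
  "ehrhart P = (\<lambda>k\<in>{1..}. card {z :: int list. map real_of_int z \<in> dilate k P})"

end

theory Submission imports Defs
begin

text \<open>
  Reflecting and reversing, \<open>x \<mapsto> rev (a - x)\<close> carries \<open>CL(a)\<close> to \<open>CL(rev a)\<close> and the sum \<open>t\<close> to
  \<open>n - t\<close>, so it suffices that the generating function by coordinate sum of the lattice points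
  is invariant under reversing \<open>a\<close>. Since \<open>2 l \<le> a\<^sub>i\<close>, two consecutive link inequalities are never
  violated together, and inclusion--exclusion expresses the generating function as the trace of a
  product of the \<open>2 \<times> 2\<close> matrices with rows \<open>(1 + q + \<dots> + q\<^sup>a, - w q\<^sup>a)\<close> and \<open>(1, 0)\<close>, where \<open>w\<close>
  does not depend on \<open>a\<close>. One symmetric matrix \<open>S\<close> makes \<open>T S\<close> symmetric for all these matrices
  \<open>T\<close>, hence the trace of the product does not change when the order is reversed.
\<close>

section \<open>Sums over boxes\<close>

definition box :: "nat list \<Rightarrow> nat list set" where
  "box as = {xs. list_all2 (\<le>) xs as}"

lemma box_Nil [simp]: "box [] = {[]}"
  by (auto simp: box_def)

lemma box_Cons: "box (a # as) = (\<lambda>(x, xs). x # xs) ` ({..a} \<times> box as)"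
  by (auto simp: box_def list_all2_Cons2 image_iff)

lemma finite_box [simp]: "finite (box as)"
  by (induction as) (auto simp: box_Cons)

lemma length_box: "xs \<in> box as \<Longrightarrow> length xs = length as"
  by (auto simp: box_def list_all2_lengthD)

lemma sum_box_Cons: "(\<Sum>xs\<in>box (a # as). f xs) = (\<Sum>x\<le>a. \<Sum>xs\<in>box as. f (x # xs))"
proof -
  have "inj_on (\<lambda>(x, xs). x # xs) ({..a} \<times> box as)"
    by (auto simp: inj_on_def)
  then show ?thesis
    by (simp add: box_Cons sum.reindex sum.cartesian_product case_prod_unfold)
qed

lemma sum_box_snoc: "(\<Sum>xs\<in>box (as @ [b]). f xs) = (\<Sum>xs\<in>box as. \<Sum>y\<le>b. f (xs @ [y]))"
  by (induction as arbitrary: f) (simp_all add: sum_box_Cons)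

section \<open>Chains of link inequalities\<close>

text \<open>If \<open>xs\<close> has one more entry than \<open>as\<close>, then each entry of \<open>as\<close> gives an inequality; if the
  lengths agree, then the last entry of \<open>as\<close> is ignored.\<close>

fun chain :: "nat \<Rightarrow> nat list \<Rightarrow> nat list \<Rightarrow> bool" where
  "chain l (a # as) (x # y # ys) \<longleftrightarrow> l + x \<le> a + y \<and> chain l as (y # ys)"
| "chain l _ _ \<longleftrightarrow> True"

lemma chain_append:
  "length us = length as \<Longrightarrow>
    chain l (as @ bs) (us @ v # vs) \<longleftrightarrow> chain l as (us @ [v]) \<and> chain l bs (v # vs)"
proof (induction us as rule: list_induct2)
  case (Cons u us a as)
  then show ?case by (cases us) auto
qed simp

lemma chain_nth:
  "chain l as xs \<longleftrightarrow> (\<forall>i<length as. Suc i < length xs \<longrightarrow> l + xs ! i \<le> as ! i + xs ! Suc i)"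
proof (induction l as xs rule: chain.induct)
  case (1 l a as x y ys)
  show ?case
    unfolding chain.simps 1 by (auto simp: less_Suc_eq_0_disj)
qed auto

section \<open>Generating functions of open and closed chains, and inclusion--exclusion on one
  link\<close>

definition path_sum :: "nat \<Rightarrow> real \<Rightarrow> nat list \<Rightarrow> real" where
  "path_sum l q as = (\<Sum>xs\<in>box as. of_bool (chain l as xs) * q ^ sum_list xs)"

text \<open>Appending \<open>hd xs\<close> adds the link from the last entry back to the first,
  which \<open>path_sum\<close> leaves out.\<close>

definition cycle_sum :: "nat \<Rightarrow> real \<Rightarrow> nat list \<Rightarrow> real" where
  "cycle_sum l q as = (\<Sum>xs\<in>box as. of_bool (chain l as (xs @ [hd xs])) * q ^ sum_list xs)"

definition geo :: "real \<Rightarrow> nat \<Rightarrow> real" where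
  "geo q a = (\<Sum>x\<le>a. q ^ x)"

definition defect :: "nat \<Rightarrow> real \<Rightarrow> real" where
  "defect l q = (\<Sum>u<l. \<Sum>y<l - u. q ^ y / q ^ u)"

lemma defect_nonneg: "0 < q \<Longrightarrow> 0 \<le> defect l q"
  by (auto simp: defect_def intro!: sum_nonneg)

lemma geo_closed: "(1 - q) * geo q a = 1 - q * q ^ a"
  using sum_gp_basic[of q a] by (simp add: geo_def)

text \<open>With \<open>x = a - u\<close> the violation reads \<open>y < l - u\<close>, and
  \<open>q ^ (x + y)\<close> is \<open>q ^ a\<close> times \<open>q ^ y / q ^ u\<close>. Since
  \<open>l\<close> is at most \<open>a\<close> and \<open>b\<close>, neither range is cut off, so
  the remaining factor depends on neither.\<close>

lemma sum_violated:
  assumes "l \<le> a" "l \<le> b" "0 < q"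
  shows "(\<Sum>x\<le>a. \<Sum>y\<le>b. of_bool (a + y < l + x) * q ^ (x + y)) = q ^ a * defect l q"
proof -
  have inner: "(\<Sum>y\<le>b. of_bool (a + y < l + (a - u)) * q ^ (a - u + y)) =
      (if u < l then \<Sum>y<l - u. q ^ a * (q ^ y / q ^ u) else 0)" if "u \<le> a" for u
  proof -
    have "(\<Sum>y\<le>b. of_bool (a + y < l + (a - u)) * q ^ (a - u + y)) =
        (\<Sum>y<l - u. q ^ (a - u + y))"
      using that assms by (intro sum.mono_neutral_cong_right) auto
    also have "\<dots> = (\<Sum>y<l - u. q ^ a * (q ^ y / q ^ u))"
      using that assms by (intro sum.cong) (auto simp: power_add power_diff)
    finally show ?thesis by simp
  qed
  have "(\<Sum>x\<le>a. \<Sum>y\<le>b. of_bool (a + y < l + x) * q ^ (x + y)) =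
      (\<Sum>u\<le>a. \<Sum>y\<le>b. of_bool (a + y < l + (a - u)) * q ^ (a - u + y))"
    by (rule sum.atLeastAtMost_rev[of _ 0 a, simplified atLeast0AtMost, simplified])
  also have "\<dots> = (\<Sum>u\<le>a. if u < l then \<Sum>y<l - u. q ^ a * (q ^ y / q ^ u) else 0)"
    by (intro sum.cong refl inner) simp
  also have "\<dots> = (\<Sum>u<l. \<Sum>y<l - u. q ^ a * (q ^ y / q ^ u))"
    using assms by (intro sum.mono_neutral_cong_right) auto
  finally show ?thesis
    by (simp add: defect_def sum_distrib_left)
qed

lemma path_sum_Nil [simp]: "path_sum l q [] = 1"
  by (simp add: path_sum_def)

lemma path_sum_single [simp]: "path_sum l q [a] = geo q a"
  by (simp add: path_sum_def geo_def sum_box_Cons)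

text \<open>For \<open>x \<le> l\<close> the first link is automatic:
  \<open>l + x \<le> 2 * l \<le> a\<close>.\<close>

lemma chain_Cons_small:
  assumes "length ys = length as" "2 * l \<le> a" "x \<le> l"
  shows "chain l (a # as) (x # ys) \<longleftrightarrow> chain l as ys"
  using assms by (cases ys; cases as) auto

text \<open>Drop the first link and subtract the tuples violating it. With \<open>x \<le> a\<close>,
  a violation forces \<open>y < l\<close>, so the next link is automatic and the rest is a free
  chain over \<open>as\<close>.\<close>

lemma path_sum_Cons:
  assumes "2 * l \<le> a" "2 * l \<le> b" "0 < q"
  shows "path_sum l q (a # b # as) =
    geo q a * path_sum l q (b # as) - q ^ a * defect l q * path_sum l q as"
proof -
  have split: "of_bool (chain l (a # b # as) (x # y # zs)) =
      of_bool (chain l (b # as) (y # zs)) -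
      of_bool (a + y < l + x) * (of_bool (chain l as zs) :: real)"
    if "x \<le> a" "zs \<in> box as" for x y zs
    using chain_Cons_small[of zs as l b y] that assms by (auto dest: length_box)
  have "path_sum l q (a # b # as) = (\<Sum>x\<le>a. \<Sum>y\<le>b. \<Sum>zs\<in>box as.
      q ^ x * (of_bool (chain l (b # as) (y # zs)) * q ^ (y + sum_list zs)) -
      of_bool (a + y < l + x) * q ^ (x + y) * (of_bool (chain l as zs) * q ^ sum_list zs))"
    unfolding path_sum_def sum_box_Cons
    by (intro sum.cong refl, subst split) (auto simp: power_add algebra_simps)
  also have "\<dots> = geo q a * path_sum l q (b # as) -
      (\<Sum>x\<le>a. \<Sum>y\<le>b. of_bool (a + y < l + x) * q ^ (x + y)) * path_sum l q as"
    unfolding sum_subtractf geo_def path_sum_def sum_box_Cons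
    by (simp only: sum_distrib_right) (simp only: sum_distrib_left sum_list.Cons)
  also have "(\<Sum>x\<le>a. \<Sum>y\<le>b. of_bool (a + y < l + x) * q ^ (x + y)) = q ^ a * defect l q"
    by (rule sum_violated) (use assms in simp_all)
  finally show ?thesis .
qed

lemma cycle_sum_single: "l \<le> a \<Longrightarrow> cycle_sum l q [a] = geo q a"
  by (simp add: cycle_sum_def geo_def sum_box_Cons)

text \<open>Inclusion--exclusion on the closing link. If it fails, then \<open>x < l\<close> and
  \<open>y > b - l \<ge> l\<close>, so the links leaving \<open>x\<close> and entering
  \<open>y\<close> are both automatic and only the chain over the interior remains.\<close>

lemma cycle_sum_ends:
  assumes "2 * l \<le> a" "2 * l \<le> b" "0 < q"
  shows "cycle_sum l q (a # as @ [b]) =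
    path_sum l q (a # as @ [b]) - q ^ b * defect l q * path_sum l q as"
proof -
  have inner: "chain l (a # as @ [b]) (x # zs @ [y]) \<longleftrightarrow> chain l as zs"
    if "y \<le> b" "zs \<in> box as" "b + x < l + y" for x y zs
  proof -
    have len: "length zs = length as"
      using that by (auto dest: length_box)
    \<comment> \<open>The link into \<open>y\<close> reads \<open>l + u \<le> c + y\<close>, which
      follows from \<open>u \<le> c\<close> and \<open>l \<le> y\<close>.\<close>
    have "chain l as (zs @ [y]) \<longleftrightarrow> chain l as zs"
    proof (cases zs rule: rev_cases)
      case (snoc us u)
      then obtain cs c where as: "as = cs @ [c]" "length us = length cs"
        using len by (cases as rule: rev_cases) auto
      moreover have "u \<le> c"
        using that(2) as snoc by (auto simp: box_def list_all2_append)
      ultimately show ?thesis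
        using that assms snoc chain_append[of us cs l "[c]" u "[y]"]
          chain_append[of us cs l "[c]" u "[]"] by auto
    qed (use len in auto)
    then show ?thesis
      using that assms len chain_Cons_small[of "zs @ [y]" "as @ [b]" l a x]
        chain_append[of zs as l "[b]" y "[]"] by auto
  qed
  have split: "of_bool (chain l (a # as @ [b]) ((x # zs @ [y]) @ [hd (x # zs @ [y])])) =
      of_bool (chain l (a # as @ [b]) (x # zs @ [y])) -
      of_bool (b + x < l + y) * (of_bool (chain l as zs) :: real)"
    if "y \<le> b" "zs \<in> box as" for x y zs
    using inner[OF that, of x] that(2) chain_append[of "x # zs" "a # as" l "[b]" y "[x]"]
      chain_append[of "x # zs" "a # as" l "[b]" y "[]"]
    by (auto dest: length_box)
  have "cycle_sum l q (a # as @ [b]) = (\<Sum>x\<le>a. \<Sum>zs\<in>box as. \<Sum>y\<le>b.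
      of_bool (chain l (a # as @ [b]) (x # zs @ [y])) * q ^ sum_list (x # zs @ [y]) -
      of_bool (b + x < l + y) * q ^ (y + x) * (of_bool (chain l as zs) * q ^ sum_list zs))"
    unfolding cycle_sum_def sum_box_Cons sum_box_snoc
    by (intro sum.cong refl, subst split) (auto simp: power_add algebra_simps)
  also have "\<dots> = path_sum l q (a # as @ [b]) -
      (\<Sum>x\<le>a. \<Sum>zs\<in>box as. \<Sum>y\<le>b.
        of_bool (b + x < l + y) * q ^ (y + x) * (of_bool (chain l as zs) * q ^ sum_list zs))"
    unfolding sum_subtractf path_sum_def sum_box_Cons sum_box_snoc by simp
  also have "(\<Sum>x\<le>a. \<Sum>zs\<in>box as. \<Sum>y\<le>b.
        of_bool (b + x < l + y) * q ^ (y + x) * (of_bool (chain l as zs) * q ^ sum_list zs)) =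
      (\<Sum>x\<le>a. \<Sum>y\<le>b. of_bool (b + x < l + y) * q ^ (y + x)) * path_sum l q as"
    unfolding path_sum_def sum_distrib_right
    by (rule sum.cong[OF refl], subst sum.swap) (simp only: sum_distrib_left)
  also have "(\<Sum>x\<le>a. \<Sum>y\<le>b. of_bool (b + x < l + y) * q ^ (y + x)) = q ^ b * defect l q"
    by (subst sum.swap) (rule sum_violated[OF _ _ assms(3)]; use assms in simp)
  finally show ?thesis .
qed

section \<open>Reversal invariance of the trace\<close>

text \<open>The tuple \<open>(A, B, C, D)\<close> stands for the matrix with rows \<open>(A, - w B)\<close> and \<open>(C, D)\<close>; with the
  factor \<open>- w\<close> split off, the case \<open>w = 0\<close> needs no separate treatment.\<close>

primrec transfer :: "real \<Rightarrow> real \<Rightarrow> nat list \<Rightarrow> real \<times> real \<times> real \<times> real" where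
  "transfer w q [] = (1, 0, 0, 1)"
| "transfer w q (a # as) = (case transfer w q as of (A, B, C, D) \<Rightarrow>
    (geo q a * A - w * q ^ a * C, geo q a * B + q ^ a * D, A, - w * B))"

lemma transfer_snoc:
  "transfer w q (as @ [a]) = (case transfer w q as of (A, B, C, D) \<Rightarrow>
    (A * geo q a - w * B, q ^ a * A, C * geo q a + D, - w * q ^ a * C))"
  by (induction as) (simp_all add: case_prod_unfold algebra_simps)

text \<open>The four equations say \<open>M S = S N\<^sup>T\<close> for the matrices \<open>M\<close>, \<open>N\<close> of the list and its reverse and
  the matrix \<open>S\<close> with rows \<open>(- w, - w (1 - q))\<close> and \<open>(- w (1 - q), q)\<close>.\<close>

lemma transfer_rev:
  assumes "transfer w q as = (A, B, C, D)" "transfer w q (rev as) = (A', B', C', D')"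
  shows "A - w * (1 - q) * B = A' - w * (1 - q) * B'"
    and "(1 - q) * A + q * B = C' + (1 - q) * D'"
    and "C + (1 - q) * D = (1 - q) * A' + q * B'"
    and "q * D - w * (1 - q) * C = q * D' - w * (1 - q) * C'"
proof -
  have "A - w * (1 - q) * B = A' - w * (1 - q) * B' \<and>
    (1 - q) * A + q * B = C' + (1 - q) * D' \<and>
    C + (1 - q) * D = (1 - q) * A' + q * B' \<and>
    q * D - w * (1 - q) * C = q * D' - w * (1 - q) * C'"
    using assms
  proof (induction as arbitrary: A B C D A' B' C' D')
    case (Cons a as)
    obtain E F G H E' F' G' H' where
      M: "transfer w q as = (E, F, G, H)" and N: "transfer w q (rev as) = (E', F', G', H')"
      by (metis prod_cases4)
    note IH = Cons.IH[OF M N]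
    have eqs: "A = geo q a * E - w * q ^ a * G" "B = geo q a * F + q ^ a * H" "C = E" "D = - w * F"
      "A' = E' * geo q a - w * F'" "B' = q ^ a * E'" "C' = G' * geo q a + H'"
      "D' = - w * q ^ a * G'"
      using Cons.prems M N by (auto simp: transfer_snoc)
    have geo: "(1 - q) * geo q a = 1 - q * q ^ a"
      by (rule geo_closed)
    \<comment> \<open>For the matrix \<open>T\<close> of \<open>a\<close>, the step is
      \<open>T M S = T S N^T = S T^T N^T = S (N T)^T\<close>. The identity
      \<open>T S = S T^T\<close> amounts to \<open>(1 - q) * n = 1 - q * X\<close>, the only
      relation between \<open>n\<close> and \<open>X\<close> that is used.\<close>
    define n X where "n = geo q a" and "X = q ^ a"
    have 1: "E - w * (1 - q) * F = E' - w * (1 - q) * F'"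
      and 2: "(1 - q) * E + q * F = G' + (1 - q) * H'"
      and 3: "G + (1 - q) * H = (1 - q) * E' + q * F'"
      and 4: "q * H - w * (1 - q) * G = q * H' - w * (1 - q) * G'"
      and 5: "(1 - q) * n = 1 - q * X"
      using IH geo by (simp_all add: n_def X_def)
    show ?case
      unfolding eqs n_def[symmetric] X_def[symmetric]
    proof (intro conjI)
      show "n * E - w * X * G - w * (1 - q) * (n * F + X * H) =
          E' * n - w * F' - w * (1 - q) * (X * E')"
        using 1 3 5 by algebra
      show "(1 - q) * (n * E - w * X * G) + q * (n * F + X * H) =
          G' * n + H' + (1 - q) * (- w * X * G')"
        using 2 4 5 by algebra
      show "E + (1 - q) * (- w * F) = (1 - q) * (E' * n - w * F') + q * (X * E')"
        using 1 5 by algebra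
      show "q * (- w * F) - w * (1 - q) * E = q * (- w * X * G') - w * (1 - q) * (G' * n + H')"
        using 2 5 by algebra
    qed
  qed auto
  then show "A - w * (1 - q) * B = A' - w * (1 - q) * B'"
    and "(1 - q) * A + q * B = C' + (1 - q) * D'"
    and "C + (1 - q) * D = (1 - q) * A' + q * B'"
    and "q * D - w * (1 - q) * C = q * D' - w * (1 - q) * C'"
    by auto
qed

text \<open>When \<open>S\<close> is invertible, \<open>M S = S N^T\<close> makes \<open>M\<close>
  similar to the transpose of \<open>N\<close>, so the traces agree.\<close>

lemma transfer_trace_rev:
  assumes "transfer w q as = (A, B, C, D)" "transfer w q (rev as) = (A', B', C', D')"
    and "0 < q" "0 \<le> w"
  shows "A + D = A' + D'"
proof -
  note eqs = transfer_rev[OF assms(1,2)]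
  \<comment> \<open>The determinant of \<open>S\<close> is \<open>- w\<close> times this factor,
    which stays positive even for \<open>w = 0\<close>.\<close>
  have "(q + w * (1 - q)\<^sup>2) * ((A + D) - (A' + D')) = 0"
    using eqs by algebra
  moreover have "q + w * (1 - q)\<^sup>2 > 0"
    using assms by (simp add: add_pos_nonneg)
  ultimately show ?thesis by simp
qed

section \<open>Chain sums as matrix entries and traces\<close>

lemma transfer_path_sum:
  assumes "\<forall>a\<in>set as. 2 * l \<le> a" "0 < q"
    and "transfer (defect l q) q as = (A, B, C, D)"
  shows "A = path_sum l q as" "as \<noteq> [] \<Longrightarrow> C = path_sum l q (tl as)"
proof -
  have "A = path_sum l q as \<and> (as \<noteq> [] \<longrightarrow> C = path_sum l q (tl as))"
    using assms
  proof (induction as arbitrary: A B C D)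
    case (Cons a as)
    then show ?case
      by (cases as) (auto simp: path_sum_Cons split: prod.splits)
  qed auto
  then show "A = path_sum l q as" "as \<noteq> [] \<Longrightarrow> C = path_sum l q (tl as)"
    by auto
qed

text \<open>Splitting off the last factor gives \<open>D\<close> as \<open>- w * q ^ b\<close> times
  the path sum of the interior, which is the correction term in \<open>cycle_sum_ends\<close>. For a
  single entry, \<open>D = 0\<close>.\<close>

lemma cycle_sum_transfer:
  assumes "as \<noteq> []" "\<forall>a\<in>set as. 2 * l \<le> a" "0 < q"
    and M: "transfer (defect l q) q as = (A, B, C, D)"
  shows "cycle_sum l q as = A + D"
proof (cases as)
  case (Cons a bs)
  show ?thesis
  proof (cases bs rule: rev_cases)
    case Nil
    then show ?thesis
      using assms Cons by (auto simp: cycle_sum_single)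
  next
    case (snoc cs b)
    obtain E F G H where N: "transfer (defect l q) q (a # cs) = (E, F, G, H)"
      by (metis prod_cases4)
    have "G = path_sum l q cs"
      using transfer_path_sum(2)[OF _ _ N] assms Cons snoc by auto
    moreover have "D = - defect l q * q ^ b * G"
      using M transfer_snoc[of _ _ "a # cs" b] N Cons snoc by auto
    moreover have "A = path_sum l q as"
      using transfer_path_sum(1)[OF _ _ M] assms by auto
    ultimately show ?thesis
      using assms Cons snoc by (simp add: cycle_sum_ends)
  qed
qed (use assms in auto)

lemma cycle_sum_rev:
  assumes "as \<noteq> []" "\<forall>a\<in>set as. 2 * l \<le> a" "0 < q"
  shows "cycle_sum l q (rev as) = cycle_sum l q as"
proof -
  obtain A B C D A' B' C' D' where
    M: "transfer (defect l q) q as = (A, B, C, D)" and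
    N: "transfer (defect l q) q (rev as) = (A', B', C', D')"
    by (metis prod_cases4)
  have "A + D = A' + D'"
    using transfer_trace_rev[OF M N] assms defect_nonneg by auto
  moreover have "cycle_sum l q as = A + D" "cycle_sum l q (rev as) = A' + D'"
    using cycle_sum_transfer[OF _ _ _ M] cycle_sum_transfer[OF _ _ _ N] assms by auto
  ultimately show ?thesis by simp
qed

section \<open>Counting lattice points\<close>

definition links :: "nat \<Rightarrow> nat list \<Rightarrow> nat list set" where
  "links l as = {xs \<in> box as. chain l as (xs @ [hd xs])}"

lemma finite_links [simp]: "finite (links l as)"
  by (simp add: links_def)

lemma mem_links_iff:
  assumes "as \<noteq> []"
  shows "xs \<in> links l as \<longleftrightarrow> length xs = length as \<and>
    (\<forall>i<length as. xs ! i \<le> as ! i \<and> l + xs ! i \<le> as ! i + xs ! ((i + 1) mod length as))"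
proof -
  have next_entry: "(xs @ [hd xs]) ! Suc i = xs ! ((i + 1) mod length as)"
    if "length xs = length as" "i < length as" for i
    using that assms by (cases "Suc i = length as"; cases xs) (auto simp: nth_append)
  have "(xs @ [hd xs]) ! i = xs ! i" if "length xs = length as" "i < length as" for i
    using that by (simp add: nth_append)
  with next_entry show ?thesis
    unfolding links_def box_def chain_nth list_all2_conv_all_nth by auto
qed

lemma cycle_sum_eq: "cycle_sum l q as = (\<Sum>xs\<in>links l as. q ^ sum_list xs)"
  unfolding cycle_sum_def links_def
  by (intro sum.mono_neutral_cong_right) auto

lemma box_sum_list_le: "xs \<in> box as \<Longrightarrow> sum_list xs \<le> sum_list as"
  unfolding box_def mem_Collect_eq by (induction rule: list_all2_induct) auto

lemma sum_power_by_degree: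
  fixes q :: real
  assumes "finite S" "\<And>x. x \<in> S \<Longrightarrow> f x \<le> N"
  shows "(\<Sum>x\<in>S. q ^ f x) = (\<Sum>m\<le>N. real (card {x \<in> S. f x = m}) * q ^ m)"
proof -
  have "(\<Sum>x\<in>S. q ^ f x) = (\<Sum>m\<le>N. \<Sum>x\<in>{x \<in> S. f x = m}. q ^ f x)"
    using assms by (intro sum.group[symmetric]) auto
  then show ?thesis by simp
qed

text \<open>The two generating functions are polynomials in \<open>q\<close> that agree for all
  \<open>q > 0\<close>, hence have equal coefficients.\<close>

lemma card_links_rev:
  assumes "as \<noteq> []" "\<forall>a\<in>set as. 2 * l \<le> a"
  shows "card {xs \<in> links l (rev as). sum_list xs = m} = card {xs \<in> links l as. sum_list xs = m}"
proof -
  \<comment> \<open>The maximum makes \<open>m\<close> a valid coefficient index even beyond the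
    degree.\<close>
  define N where "N = max m (sum_list as)"
  define c where "c bs j = real (card {xs \<in> links l bs. sum_list xs = j})" for bs j
  have expand: "cycle_sum l q bs = (\<Sum>j\<le>N. c bs j * q ^ j)" if "sum_list bs = sum_list as" for q bs
    unfolding cycle_sum_eq c_def
    using that box_sum_list_le[of _ bs]
    by (intro sum_power_by_degree) (auto simp: links_def N_def le_max_iff_disj)
  have "(\<Sum>j\<le>N. (c (rev as) j - c as j) * q ^ j) = 0" if "0 < q" for q
    using cycle_sum_rev[OF assms that] expand[of as q] expand[of "rev as" q]
    by (simp add: left_diff_distrib sum_subtractf)
  then have "{0<..} \<subseteq> {q. (\<Sum>j\<le>N. (c (rev as) j - c as j) * q ^ j) = 0}"
    by auto
  then have "infinite {q. (\<Sum>j\<le>N. (c (rev as) j - c as j) * q ^ j) = 0}"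
    using infinite_Ioi infinite_super by blast
  then have "c (rev as) m - c as m = 0"
    using polyfun_finite_roots[of "\<lambda>j. c (rev as) j - c as j" N] by (auto simp: N_def)
  then show ?thesis
    by (simp add: c_def)
qed

section \<open>Reflection of the box\<close>

definition reflect :: "nat list \<Rightarrow> nat list \<Rightarrow> nat list" where
  "reflect as xs = rev (map2 (-) as xs)"

lemma reflect_reflect: "xs \<in> box as \<Longrightarrow> reflect (rev as) (reflect as xs) = xs"
  unfolding box_def reflect_def mem_Collect_eq
  by (induction rule: list_all2_induct) (auto simp: list_all2_lengthD)

lemma sum_list_reflect: "xs \<in> box as \<Longrightarrow> sum_list (reflect as xs) + sum_list xs = sum_list as"
  unfolding box_def reflect_def mem_Collect_eq
  by (induction rule: list_all2_induct) auto

text \<open>For \<open>y = a - x\<close> the link from \<open>i\<close> to \<open>i + 1\<close>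
  becomes \<open>y_(i+1) - y_i \<le> a_(i+1) - l\<close>: its direction flips and its bound moves to
  the other end, so reversing the order restores the original form.\<close>

lemma reflect_links:
  assumes "xs \<in> links l as" "as \<noteq> []"
  shows "reflect as xs \<in> links l (rev as)"
proof -
  let ?s = "length as"
  have len: "length xs = ?s"
    and le: "\<And>i. i < ?s \<Longrightarrow> xs ! i \<le> as ! i"
    and link: "\<And>i. i < ?s \<Longrightarrow> l + xs ! i \<le> as ! i + xs ! ((i + 1) mod ?s)"
    using assms by (auto simp: mem_links_iff)
  have nth: "reflect as xs ! i = as ! (?s - Suc i) - xs ! (?s - Suc i)" if "i < ?s" for i
    using that len by (simp add: reflect_def rev_nth)
  have "l + reflect as xs ! i \<le> rev as ! i + reflect as xs ! ((i + 1) mod ?s)" if i: "i < ?s" for i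
  proof -
    \<comment> \<open>\<open>j\<close> is the original position of the cyclic successor of
      \<open>i\<close> in the reversed list, so the original link from \<open>j\<close> leads to the
      position \<open>?s - Suc i\<close> of \<open>i\<close>, also at the wrap-around.\<close>
    define j where "j = ?s - Suc ((i + 1) mod ?s)"
    have j: "j < ?s \<and> (j + 1) mod ?s = ?s - Suc i"
    proof (cases "Suc i = ?s")
      case True
      then have "j + 1 = ?s"
        using i by (simp add: j_def)
      then show ?thesis
        using True by (metis diff_self_eq_0 less_add_one mod_self)
    next
      case False
      then have "j + 1 = ?s - Suc i"
        using i by (simp add: j_def)
      then show ?thesis
        using i by (simp add: mod_less)
    qed
    have "reflect as xs ! ((i + 1) mod ?s) = as ! j - xs ! j"
      unfolding j_def by (rule nth) (rule mod_less_divisor, use assms in simp)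
    moreover have "rev as ! i = as ! (?s - Suc i)"
      using i by (simp add: rev_nth)
    moreover have "l + xs ! j \<le> as ! j + xs ! (?s - Suc i)"
      using link[of j] j by simp
    moreover have "xs ! j \<le> as ! j" "xs ! (?s - Suc i) \<le> as ! (?s - Suc i)"
      using le[of j] le[of "?s - Suc i"] j i by linarith+
    ultimately show ?thesis
      using nth[OF i] by linarith
  qed
  moreover have "reflect as xs ! i \<le> rev as ! i" if "i < ?s" for i
    using nth[OF that] that by (simp add: rev_nth)
  moreover have "length (reflect as xs) = ?s"
    using len by (simp add: reflect_def)
  ultimately show ?thesis
    using assms(2) by (simp add: mem_links_iff)
qed

lemma card_links_reflect:
  assumes "as \<noteq> []"
  shows "card {xs \<in> links l as. int (sum_list xs) = int (sum_list as) - m} =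
    card {xs \<in> links l (rev as). int (sum_list xs) = m}"
proof -
  have box: "xs \<in> links l bs \<Longrightarrow> xs \<in> box bs" for xs bs
    by (simp add: links_def)
  have sum: "int (sum_list (reflect bs xs)) = int (sum_list bs) - int (sum_list xs)"
    if "xs \<in> links l bs" for bs xs
    using sum_list_reflect[OF box[OF that]] by linarith
  show ?thesis
    by (intro bij_betw_same_card[OF bij_betw_byWitness[where f = "reflect as"
            and f' = "reflect (rev as)"]])
      (use assms reflect_links[of _ l as] reflect_links[of _ l "rev as"]
         reflect_reflect[of _ as] reflect_reflect[of _ "rev as"] sum box in auto)
qed

lemma card_links_complement:
  assumes "as \<noteq> []" "\<forall>a\<in>set as. 2 * l \<le> a"
  shows "card {xs \<in> links l as. int (sum_list xs) = int (sum_list as) - m} =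
    card {xs \<in> links l as. int (sum_list xs) = m}"
proof (cases m)
  case (nonneg k)
  then show ?thesis
    using card_links_reflect[OF assms(1), of l m] card_links_rev[OF assms, of k] by simp
next
  \<comment> \<open>No tuple of naturals has a negative sum; by reflection, none has a sum above the
    total either.\<close>
  case (neg k)
  then have empty: "{xs \<in> links l bs. int (sum_list xs) = m} = {}" for bs
    by auto
  show ?thesis
    unfolding card_links_reflect[OF assms(1)] empty by simp
qed

section \<open>Dilation and the Ehrhart function\<close>

lemma mem_dilate_iff:
  assumes "k > 0"
  shows "z \<in> dilate k P \<longleftrightarrow> map (\<lambda>y. y / real k) z \<in> P"
proof
  assume "map (\<lambda>y. y / real k) z \<in> P"
  then show "z \<in> dilate k P"
    unfolding dilate_def using assms
    by (intro image_eqI[where x = "map (\<lambda>y. y / real k) z"]) (auto simp: o_def)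
qed (use assms in \<open>auto simp: dilate_def o_def\<close>)

text \<open>Dilating by \<open>k\<close> multiplies the bounds, \<open>l\<close> and the coordinate
  sum by \<open>k\<close>. The integer \<open>t\<close> allows for negative sections.\<close>

lemma lattice_points_section:
  assumes "k > 0" "as \<noteq> []"
  shows "{z :: int list. map real_of_int z \<in> dilate k (chainlink_section as l (real_of_int t))} =
    map int ` {xs \<in> links (k * l) (map ((*) k) as). int (sum_list xs) = int k * t}"
    (is "?L = ?R")
proof -
  have iff: "map real_of_int (map int xs) \<in> dilate k (chainlink_section as l (real_of_int t)) \<longleftrightarrow>
      xs \<in> links (k * l) (map ((*) k) as) \<and> int (sum_list xs) = int k * t" for xs
  proof -
    have le: "real x / real k \<le> real a \<longleftrightarrow> x \<le> k * a" for x a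
      using assms by (simp add: divide_le_eq mult.commute flip: of_nat_mult)
    have link: "real x / real k - real y / real k \<le> real a - real l \<longleftrightarrow> k * l + x \<le> k * a + y"
      for x y a
    proof -
      have "real x / real k - real y / real k \<le> real a - real l \<longleftrightarrow>
          real x - real y \<le> real k * (real a - real l)"
        using assms by (simp add: divide_le_eq mult.commute flip: diff_divide_distrib)
      also have "\<dots> \<longleftrightarrow> real (k * l + x) \<le> real (k * a + y)"
        by (simp add: algebra_simps)
      finally show ?thesis
        by (simp only: of_nat_le_iff)
    qed
    have "sum_list (map (\<lambda>x. real x / real k) xs) = real (sum_list xs) / real k"
      by (induction xs) (auto simp: add_divide_distrib)
    then have "sum_list (map (\<lambda>x. real x / real k) xs) = real_of_int t \<longleftrightarrow>
        real_of_int (int (sum_list xs)) = real_of_int (int k * t)"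
      using assms by (auto simp: field_simps)
    then have sum: "sum_list (map (\<lambda>x. real x / real k) xs) = real_of_int t \<longleftrightarrow>
        int (sum_list xs) = int k * t"
      by (simp only: of_int_eq_iff)
    show ?thesis
      using assms
      by (auto simp: mem_dilate_iff chainlink_section_def chainlink_def mem_links_iff o_def
          sum le link)
  qed
  \<comment> \<open>The constraints \<open>0 \<le> x ! i\<close> ensure that lists of naturals
    capture every lattice point.\<close>
  have "z \<in> range (map int)" if "z \<in> ?L" for z
  proof -
    have "0 \<le> z ! i" if "i < length z" for i
    proof -
      have "0 \<le> real_of_int (z ! i) / real k"
        using \<open>z \<in> ?L\<close> that assms
        by (auto simp: mem_dilate_iff chainlink_section_def chainlink_def)
      then show ?thesis
        using assms by (simp add: zero_le_divide_iff)
    qed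
    then have "z = map int (map nat z)"
      by (auto simp: list_eq_iff_nth_eq)
    then show ?thesis by blast
  qed
  then show ?thesis
    using iff by blast
qed

lemma ehrhart_section:
  assumes "k > 0" "as \<noteq> []"
  shows "ehrhart (chainlink_section as l (real_of_int t)) k =
    card {xs \<in> links (k * l) (map ((*) k) as). int (sum_list xs) = int k * t}"
  using assms card_image[OF inj_on_subset[OF inj_mapI[OF inj_of_nat] subset_UNIV]]
  by (simp add: ehrhart_def lattice_points_section)

theorem theorem1:
  fixes a :: "nat list" and n l t :: nat
  assumes "composition a n"
    and "2 * l \<le> Min (set a)"
    and "t > 0"
  shows "ehrhart (chainlink_section a l (real t)) =
         ehrhart (chainlink_section a l (real n - real t))"
proof
  fix k
  have a: "a \<noteq> []" and n: "sum_list a = n"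
    using assms by (auto simp: composition_def)
  show "ehrhart (chainlink_section a l (real t)) k =
      ehrhart (chainlink_section a l (real n - real t)) k"
  proof (cases "k > 0")
    case True
    let ?as = "map ((*) k) a"
    have sum: "int (sum_list ?as) = int k * int n"
      using n by (simp add: sum_list_const_mult)
    \<comment> \<open>The hypothesis on \<open>l\<close> scales with \<open>k\<close>, so the
      complement lemma applies to each dilate.\<close>
    have "\<forall>p\<in>set ?as. 2 * (k * l) \<le> p"
      using assms(2) a by (auto simp: mult.left_commute)
    then have "card {xs \<in> links (k * l) ?as. int (sum_list xs) = int k * (int n - int t)} =
        card {xs \<in> links (k * l) ?as. int (sum_list xs) = int k * int t}"
      using card_links_complement[of ?as "k * l" "int k * int t"] a
      unfolding sum by (simp add: right_diff_distrib)
    then show ?thesis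
      using ehrhart_section[OF True a, of l "int t"] ehrhart_section[OF True a, of l "int n - int t"]
      by simp
  \<comment> \<open>At \<open>k = 0\<close> both functions take the value
    \<open>undefined\<close>.\<close>
  qed (simp add: ehrhart_def)
qed

end
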